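(* Let ancillae $A_1,\dots,A_n$ ($n\ge2$) consecutively measure a $d$-dimensional prepared quantum system $Q$, and let detectors $D_1,\dots,D_n$ amplify them. Then the information the last device has about the previous device is reduced by amplification: $$S(D_n:D_{n-1})\le S(A_n:A_{n-1}),$$ where the left side is computed in the amplified state and the right side in the unamplified state.
   Context: $Q$ is $d$-dimensional, initially in $|Q\rangle=\sum_{x_1}\alpha^{(1)}_{x_1}|\widetilde{x}_1\rangle$. Ancilla $A_i$ ($d$-dimensional, basis $\{|x\rangle\}$, initially $|0\rangle$) measures $Q$ in the orthonormal basis $\{|\widetilde{x}_i\rangle\}$ via $\sum_x|\widetilde{x}_i\rangle\langle\widetilde{x}_i|\otimes U_x$, $U_x|0\rangle=|x\rangle$; with unitary $U^{(i)}_{x_{i-1}x_i}=\langle\widetilde{x}_i|\widetilde{x}_{i-1}\rangle$ the unamplified state is $\sum_{x_1,\dots,x_n}\alpha^{(1)}_{x_1}U^{(2)}_{x_1x_2}\cdots U^{(n)}_{x_{n-1}x_n}|\widetilde{x}_n\rangle_Q|x_1\rangle_{A_1}\cdots|x_n\rangle_{A_n}$. Amplification: detector $D_i$ (initially $|0\rangle$) copies $A_i$, $|x\rangle_{A_i}|0\rangle_{D_i}\mapsto|x\rangle_{A_i}|x\rangle_{D_i}$. Entropies are von Neumann (log base $d$) of reduced states; $S(X:Y)=S(X)+S(Y)-S(XY)$. *)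

theory Defs
  imports "Jordan_Normal_Form.Matrix" "Jordan_Normal_Form.Char_Poly" Complex_Main
begin

text \<open>Multipartite pure states of m qudits (each of dimension d). A basis tuple is a
  list of length m with entries < d; a state is its amplitude function on such lists
  (amplitudes outside the tuple set are irrelevant / zero).\<close>

definition tuples :: "nat \<Rightarrow> nat \<Rightarrow> nat list set" where
  "tuples d m = {xs. length xs = m \<and> set xs \<subseteq> {..<d}}"

text \<open>Reduced density matrix of the pure state psi on the subsystems at positions K
  (a list of distinct positions, in the given order): partial trace over all other
  positions of |psi><psi|, entry indexed by tuples i, j over K.\<close>

definition rdm :: "nat \<Rightarrow> nat \<Rightarrow> (nat list \<Rightarrow> complex) \<Rightarrow> nat list \<Rightarrow> nat list \<Rightarrow> nat list \<Rightarrow> complex" where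
  "rdm d m psi K i j =
     (\<Sum>x\<in>tuples d m. \<Sum>y\<in>tuples d m.
        if map (\<lambda>p. x ! p) K = i \<and> map (\<lambda>p. y ! p) K = j \<and>
           (\<forall>p<m. p \<notin> set K \<longrightarrow> x ! p = y ! p)
        then psi x * cnj (psi y) else 0)"

definition digits :: "nat \<Rightarrow> nat \<Rightarrow> nat \<Rightarrow> nat list" where
  "digits d k r = map (\<lambda>j. (r div d ^ j) mod d) [0..<k]"

definition rdm_mat :: "nat \<Rightarrow> nat \<Rightarrow> (nat list \<Rightarrow> complex) \<Rightarrow> nat list \<Rightarrow> complex mat" where
  "rdm_mat d m psi K =
     mat (d ^ length K) (d ^ length K)
       (\<lambda>(r, c). rdm d m psi K (digits d (length K) r) (digits d (length K) c))"

definition vn_entropy :: "nat \<Rightarrow> complex mat \<Rightarrow> real" where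
  "vn_entropy d rho =
     - (\<Sum>ev\<in>{ev. poly (char_poly rho) ev = 0}.
          real (order ev (char_poly rho)) *
          (if Re ev = 0 then 0 else Re ev * log (real d) (Re ev)))"

definition entropy_of :: "nat \<Rightarrow> nat \<Rightarrow> (nat list \<Rightarrow> complex) \<Rightarrow> nat list \<Rightarrow> real" where
  "entropy_of d m psi K = vn_entropy d (rdm_mat d m psi K)"

definition mutual_info :: "nat \<Rightarrow> nat \<Rightarrow> (nat list \<Rightarrow> complex) \<Rightarrow> nat list \<Rightarrow> nat list \<Rightarrow> real" where
  "mutual_info d m psi X Y =
     entropy_of d m psi X + entropy_of d m psi Y - entropy_of d m psi (X @ Y)"

text \<open>The process. Positions: Q = 0, A_i = i (1 \<le> i \<le> n), D_i = n + i.
  b i x is the vector |x~_i> of C^d (b i x q = <q|x~_i>), alpha the coefficients of the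
  initial state of Q in the basis {|x~_1>}.\<close>

definition init_state :: "nat \<Rightarrow> nat \<Rightarrow> (nat \<Rightarrow> nat \<Rightarrow> nat \<Rightarrow> complex) \<Rightarrow> (nat \<Rightarrow> complex)
    \<Rightarrow> nat list \<Rightarrow> complex" where
  "init_state d n b alpha xs =
     (if xs \<in> tuples d (n + 1) \<and> (\<forall>i\<in>{1..n}. xs ! i = 0)
      then (\<Sum>x<d. alpha x * b 1 x (xs ! 0)) else 0)"

text \<open>Ancilla A_i (in state |0>) measures Q in the basis {|x~_i>} via the unitary
  sum_x |x~_i><x~_i| (x) U_x with U_x|0> = |x>.\<close>
definition measure_step :: "nat \<Rightarrow> nat \<Rightarrow> (nat \<Rightarrow> nat \<Rightarrow> nat \<Rightarrow> complex) \<Rightarrow> nat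
    \<Rightarrow> (nat list \<Rightarrow> complex) \<Rightarrow> nat list \<Rightarrow> complex" where
  "measure_step d m b i psi xs =
     (if xs \<in> tuples d m
      then b i (xs ! i) (xs ! 0) *
           (\<Sum>q<d. cnj (b i (xs ! i) q) * psi (xs[0 := q, i := 0]))
      else 0)"

definition unamplified :: "nat \<Rightarrow> nat \<Rightarrow> (nat \<Rightarrow> nat \<Rightarrow> nat \<Rightarrow> complex) \<Rightarrow> (nat \<Rightarrow> complex)
    \<Rightarrow> nat list \<Rightarrow> complex" where
  "unamplified d n b alpha =
     foldl (\<lambda>psi i. measure_step d (n + 1) b i psi) (init_state d n b alpha) [1..<n+1]"

definition add_detectors :: "nat \<Rightarrow> nat \<Rightarrow> (nat list \<Rightarrow> complex) \<Rightarrow> nat list \<Rightarrow> complex" where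
  "add_detectors d n psi ys =
     (if ys \<in> tuples d (2 * n + 1) \<and> (\<forall>i\<in>{1..n}. ys ! (n + i) = 0)
      then psi (take (n + 1) ys) else 0)"

text \<open>Detector D_i (in |0>) copies A_i: |x>_{A_i}|0>_{D_i} \<mapsto> |x>_{A_i}|x>_{D_i}.\<close>
definition copy_step :: "nat \<Rightarrow> nat \<Rightarrow> nat \<Rightarrow> (nat list \<Rightarrow> complex) \<Rightarrow> nat list \<Rightarrow> complex" where
  "copy_step d n i psi ys =
     (if ys \<in> tuples d (2 * n + 1) \<and> ys ! (n + i) = ys ! i
      then psi (ys[n + i := 0]) else 0)"

definition amplified :: "nat \<Rightarrow> nat \<Rightarrow> (nat \<Rightarrow> nat \<Rightarrow> nat \<Rightarrow> complex) \<Rightarrow> (nat \<Rightarrow> complex)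
    \<Rightarrow> nat list \<Rightarrow> complex" where
  "amplified d n b alpha =
     foldl (\<lambda>psi i. copy_step d n i psi) (add_detectors d n (unamplified d n b alpha)) [1..<n+1]"

end

theory Submission
  imports Defs "Jordan_Normal_Form.Schur_Decomposition" "Jordan_Normal_Form.Spectral_Radius"
begin

text \<open>
  Copying the ancillae into detectors dephases them: the reduced state of any set of detectors is
  the diagonal part of the reduced state of the corresponding ancillae. The single ancillae
  \<open>A\<^sub>n\<close> and \<open>A\<^sub>n\<^sub>-\<^sub>1\<close> are already diagonal, the former because the states of \<open>Q\<close> correlated with
  it are orthonormal, the latter because the last measurement is an isometry on \<open>Q\<close> and so does
  not change what is obtained by tracing out \<open>Q\<close> and \<open>A\<^sub>n\<close>. Hence only the joint entropy changes,
  and replacing a positive semidefinite matrix by its diagonal part cannot decrease the entropy: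
  the diagonal is a doubly stochastic image of the spectrum, and \<open>x ln x\<close> is convex.
\<close>

section \<open>Diagonalization of Hermitian matrices\<close>

definition adj :: "complex mat \<Rightarrow> complex mat" where
  "adj A = mat (dim_col A) (dim_row A) (\<lambda>(i, j). cnj (A $$ (j, i)))"

lemma adj_carrier [simp]: "A \<in> carrier_mat n m \<Longrightarrow> adj A \<in> carrier_mat m n"
  by (auto simp: adj_def)

lemma dim_adj [simp]: "dim_row (adj A) = dim_col A" "dim_col (adj A) = dim_row A"
  by (auto simp: adj_def)

lemma adj_index [simp]: "i < dim_col A \<Longrightarrow> j < dim_row A \<Longrightarrow> adj A $$ (i, j) = cnj (A $$ (j, i))"
  by (simp add: adj_def)

lemma adj_adj [simp]: "adj (adj A) = A"
  by (rule eq_matI) auto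

lemma index_mult_sum:
  assumes "A \<in> carrier_mat n k" "B \<in> carrier_mat k m" "i < n" "j < m"
  shows "(A * B) $$ (i, j) = (\<Sum>l<k. A $$ (i, l) * B $$ (l, j))"
  using assms by (auto simp: scalar_prod_def atLeast0LessThan)

lemma adj_mult:
  assumes A: "A \<in> carrier_mat n k" and B: "B \<in> carrier_mat k m"
  shows "adj (A * B) = adj B * adj A"
proof (rule eq_matI)
  fix i j assume "i < dim_row (adj B * adj A)" "j < dim_col (adj B * adj A)"
  then have ij: "i < m" "j < n" using A B by auto
  have "adj (A * B) $$ (i, j) = cnj (\<Sum>l<k. A $$ (j, l) * B $$ (l, i))"
    using A B ij by (subst adj_index) (auto simp: index_mult_sum[OF A B] simp del: index_mult_mat(1))
  also have "\<dots> = (\<Sum>l<k. adj B $$ (i, l) * adj A $$ (l, j))"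
    using A B ij by (auto simp: mult.commute intro!: sum.cong)
  also have "\<dots> = (adj B * adj A) $$ (i, j)"
    by (rule index_mult_sum[symmetric]) (use A B ij in auto)
  finally show "adj (A * B) $$ (i, j) = (adj B * adj A) $$ (i, j)" .
qed (use A B in auto)

text \<open>Complete \<open>v\<close> to a basis, orthogonalize it by Gram-Schmidt, which keeps the
  first vector, and normalize. The scalar \<open>c\<close> is the normalization factor of
  \<open>v\<close>.\<close>

lemma unitary_first_column:
  fixes v :: "complex vec"
  assumes v: "v \<in> carrier_vec n" and v0: "v \<noteq> 0\<^sub>v n" and n: "n > 0"
  obtains W c where "W \<in> carrier_mat n n" "adj W * W = 1\<^sub>m n" "col W 0 = c \<cdot>\<^sub>v v"
proof -
  interpret cof_vec_space n "TYPE(complex)" .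
  define ws where "ws = gram_schmidt n (basis_completion v)"
  note bc = basis_completion[OF v v0]
  note gs = gram_schmidt_result[OF bc(2) bc(4) bc(5) ws_def]
  have len: "length ws = n" using gs(4) bc(6) by simp
  have hd: "ws ! 0 = v"
  proof -
    obtain vs where vs: "basis_completion v = v # vs"
      unfolding basis_completion_def Let_def by blast
    have "hd ws = v" unfolding ws_def vs using v by (rule gram_schmidt_hd)
    then show ?thesis using len n by (cases ws) auto
  qed
  have wsc: "ws ! i \<in> carrier_vec n" if "i < n" for i
    using gs(3) len that by auto
  \<comment> \<open>The equivalence gives orthogonality and, at \<open>i = j\<close>, the nonzero
    norms needed to normalize.\<close>
  have ip: "(\<Sum>k<n. ws ! j $ k * cnj (ws ! i $ k)) = 0 \<longleftrightarrow> i \<noteq> j" if "i < n" "j < n" for i j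
    using corthogonalD[OF gs(2), of j i] len that wsc[of i] wsc[of j]
    by (auto simp: scalar_prod_def atLeast0LessThan)
  define s where "s i = (\<Sum>k<n. (cmod (ws ! i $ k))\<^sup>2)" for i
  have sip: "complex_of_real (s i) = (\<Sum>k<n. ws ! i $ k * cnj (ws ! i $ k))" for i
    unfolding s_def by (simp add: complex_norm_square del: of_real_power)
  have s0: "s i > 0" if "i < n" for i
  proof -
    have "s i \<ge> 0" unfolding s_def by (simp add: sum_nonneg)
    moreover have "s i \<noteq> 0" using ip[OF that that] sip[of i] by auto
    ultimately show ?thesis by simp
  qed
  define W where "W = mat n n (\<lambda>(k, i). complex_of_real (1 / sqrt (s i)) * ws ! i $ k)"
  have W: "W \<in> carrier_mat n n" by (simp add: W_def)
  have "adj W * W = 1\<^sub>m n"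
  proof (rule eq_matI)
    fix i j assume "i < dim_row (1\<^sub>m n)" "j < dim_col (1\<^sub>m n)"
    then have ij: "i < n" "j < n" by auto
    have "(adj W * W) $$ (i, j) = (\<Sum>k<n. cnj (W $$ (k, i)) * W $$ (k, j))"
      using W ij by (subst index_mult_sum[of _ n n _ n]) auto
    also have "\<dots> = complex_of_real (1 / sqrt (s i) * (1 / sqrt (s j))) *
        (\<Sum>k<n. ws ! j $ k * cnj (ws ! i $ k))"
      using ij by (auto simp: W_def sum_distrib_left intro!: sum.cong)
    also have "\<dots> = (if i = j then 1 else 0)"
    proof (cases "i = j")
      case True
      have "sqrt (s i) * sqrt (s i) = s i" using s0[OF ij(1)] by simp
      then show ?thesis using True s0[OF ij(1)] unfolding True sip[symmetric]
        by (simp flip: of_real_mult)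
    next
      case False
      then show ?thesis using ip[OF ij] by simp
    qed
    finally show "(adj W * W) $$ (i, j) = 1\<^sub>m n $$ (i, j)" using ij by simp
  qed (use W in auto)
  moreover have "col W 0 = complex_of_real (1 / sqrt (s 0)) \<cdot>\<^sub>v v"
    using v n by (intro eq_vecI) (auto simp: W_def hd)
  ultimately show ?thesis using that W by blast
qed

text \<open>Induction on the dimension: in an orthonormal basis that starts with an eigenvector, a
  Hermitian matrix splits into the eigenvalue and a smaller Hermitian block.\<close>

theorem hermitian_diagonalization:
  assumes "A \<in> carrier_mat n n" and "adj A = A"
  shows "\<exists>U D. U \<in> carrier_mat n n \<and> D \<in> carrier_mat n n \<and> adj U * U = 1\<^sub>m n \<and>
    diagonal_mat D \<and> A = U * D * adj U"
  using assms
proof (induction n arbitrary: A)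
  case 0
  then show ?case
    by (intro exI[of _ "1\<^sub>m 0"] exI[of _ "A"]) (auto simp: diagonal_mat_def)
next
  case (Suc n)
  let ?n = "Suc n"
  note A = Suc.prems(1)
  obtain e v where ev: "eigenvector A v e"
    using spectrum_non_empty[OF A] by (auto simp: spectrum_def eigenvalue_def)
  then have v: "v \<in> carrier_vec ?n" "v \<noteq> 0\<^sub>v ?n" "A *\<^sub>v v = e \<cdot>\<^sub>v v"
    using A by (auto simp: eigenvector_def)
  obtain W c where W: "W \<in> carrier_mat ?n ?n" and WW: "adj W * W = 1\<^sub>m ?n"
    and W0: "col W 0 = c \<cdot>\<^sub>v v"
    using unitary_first_column[OF v(1,2)] by auto
  have WW': "W * adj W = 1\<^sub>m ?n"
    using mat_mult_left_right_inverse[OF adj_carrier[OF W] W WW] .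
  define A' where "A' = adj W * (A * W)"
  have A': "A' \<in> carrier_mat ?n ?n" using A W by (simp add: A'_def mult_carrier_mat[of _ ?n ?n])
  have herm: "adj A' = A'"
    using A W Suc.prems(2) by (simp add: A'_def adj_mult[of _ ?n ?n _ ?n] mult_carrier_mat[of _ ?n ?n] assoc_mult_mat[of _ ?n ?n _ ?n _ ?n])
  have AW: "A = W * A' * adj W"
  proof -
    have "W * A' * adj W = (W * adj W) * A * (W * adj W)"
      using A W unfolding A'_def
      by (smt (verit) adj_carrier assoc_mult_mat mult_carrier_mat)
    then show ?thesis using A unfolding WW' by simp
  qed
  \<comment> \<open>Column 0 of \<open>W\<close> is a multiple of the eigenvector, so
    \<open>A\<close> scales it by \<open>e\<close>, and \<open>adj W\<close> sends it to the first
    unit vector.\<close>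
  have col0: "A' $$ (i, 0) = (if i = 0 then e else 0)" if i: "i < ?n" for i
  proof -
    have "A *\<^sub>v col W 0 = e \<cdot>\<^sub>v col W 0"
      unfolding W0 using A v
      by (simp add: mult_mat_vec smult_smult_assoc mult.commute)
    moreover have "col (A * W) 0 = A *\<^sub>v col W 0"
      using A W by (intro col_mult2) auto
    ultimately have "col (A * W) 0 = e \<cdot>\<^sub>v col W 0" by simp
    then have "A' $$ (i, 0) = row (adj W) i \<bullet> (e \<cdot>\<^sub>v col W 0)"
      unfolding A'_def using i A W by simp
    also have "\<dots> = e * (adj W * W) $$ (i, 0)"
      using i W by simp
    finally show ?thesis using i unfolding WW by simp
  qed
  \<comment> \<open>Hermiticity carries the zeros of column 0 over to row 0.\<close>
  have row0: "A' $$ (0, i) = (if i = 0 then e else 0)" if i: "i < ?n" for i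
  proof (cases "i = 0")
    case False
    have "A' $$ (0, i) = adj A' $$ (0, i)" by (simp add: herm)
    also have "\<dots> = cnj (A' $$ (i, 0))" using A' i by (subst adj_index) auto
    finally show ?thesis using col0[OF i] False by simp
  qed (use col0[of 0] in auto)
  define A3 where "A3 = mat n n (\<lambda>(i, j). A' $$ (Suc i, Suc j))"
  have A3: "A3 \<in> carrier_mat n n" by (simp add: A3_def)
  have "adj A3 = A3"
  proof (rule eq_matI)
    fix i j assume "i < dim_row A3" "j < dim_col A3"
    then have ij: "i < n" "j < n" by (auto simp: A3_def)
    have "adj A' $$ (Suc i, Suc j) = cnj (A' $$ (Suc j, Suc i))"
      using A' ij by (subst adj_index) auto
    then show "adj A3 $$ (i, j) = A3 $$ (i, j)" using ij by (simp add: A3_def herm)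
  qed (auto simp: A3_def)
  from Suc.IH[OF A3 this] obtain U D where U: "U \<in> carrier_mat n n" and D: "D \<in> carrier_mat n n"
    and UU: "adj U * U = 1\<^sub>m n" and diag: "diagonal_mat D" and A3e: "A3 = U * D * adj U"
    by blast
  \<comment> \<open>The direct sum of a scalar and a matrix; products and adjoints act blockwise, so
    the diagonalization of \<open>A3\<close> extends to \<open>A'\<close>.\<close>
  define blk where "blk x M = four_block_mat (mat 1 1 (\<lambda>_. x)) (0\<^sub>m 1 n) (0\<^sub>m n 1) M"
    for x :: complex and M
  have blk: "blk x M \<in> carrier_mat ?n ?n" if "M \<in> carrier_mat n n" for x M
    using that unfolding blk_def by auto
  have blk_mult: "blk x M * blk y N = blk (x * y) (M * N)"
    if "M \<in> carrier_mat n n" "N \<in> carrier_mat n n" for x y M N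
  proof -
    have "mat 1 1 (\<lambda>_. x) * mat 1 1 (\<lambda>_. y) = mat 1 1 (\<lambda>_. x * y)"
      by (rule eq_matI) (auto simp: scalar_prod_def)
    then show ?thesis unfolding blk_def
      by (subst mult_four_block_mat[of _ 1 1 _ n _ n _ _ 1 _ n]) (use that in auto)
  qed
  have blk_adj: "adj (blk x M) = blk (cnj x) (adj M)" if "M \<in> carrier_mat n n" for x M
    unfolding blk_def by (rule eq_matI) (use that in auto)
  have blk_one: "blk 1 (1\<^sub>m n) = 1\<^sub>m ?n"
    unfolding blk_def by (rule eq_matI) auto
  have A'blk: "A' = blk e A3"
    unfolding blk_def using A' A3 col0 row0
    by (intro eq_matI) (auto simp: A3_def)
  define U' where "U' = W * blk 1 U"
  define D' where "D' = blk e D"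
  have U': "U' \<in> carrier_mat ?n ?n" using W blk[OF U] by (simp add: U'_def mult_carrier_mat[of _ ?n ?n])
  have D': "D' \<in> carrier_mat ?n ?n" using blk[OF D] by (simp add: D'_def)
  have bU: "blk 1 U \<in> carrier_mat ?n ?n" "adj (blk 1 U) \<in> carrier_mat ?n ?n" using blk[OF U] by auto
  have aW: "adj W \<in> carrier_mat ?n ?n" using W by simp
  have adjU': "adj U' = adj (blk 1 U) * adj W"
    unfolding U'_def by (rule adj_mult[OF W blk[OF U]])
  have "adj U' * U' = adj (blk 1 U) * (adj W * W) * blk 1 U"
    unfolding adjU' unfolding U'_def using W aW bU
    by (smt (verit) assoc_mult_mat mult_carrier_mat)
  also have "\<dots> = adj (blk 1 U) * blk 1 U" unfolding WW using bU by simp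
  also have "\<dots> = 1\<^sub>m ?n"
    using U by (simp add: blk_adj blk_mult UU blk_one)
  finally have 1: "adj U' * U' = 1\<^sub>m ?n" .
  have 2: "diagonal_mat D'"
    using diag D unfolding D'_def blk_def diagonal_mat_def by auto
  have "A' = blk 1 U * D' * adj (blk 1 U)"
    using U D by (simp add: A'blk A3e D'_def blk_adj blk_mult)
  then have "A = W * (blk 1 U * D' * adj (blk 1 U)) * adj W" using AW by simp
  also have "\<dots> = U' * D' * adj U'"
    unfolding adjU' unfolding U'_def using W aW bU D'
    by (smt (verit) assoc_mult_mat mult_carrier_mat)
  finally show ?case using U' D' 1 2 by blast
qed

section \<open>Entropy of the diagonal part\<close>

text \<open>\<open>vn_entropy\<close> runs over distinct roots weighted by their order. Reading the
  order as a count in a list of roots lets \<open>sum_count_list\<close> replace this by a sum with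
  repetitions.\<close>

lemma order_prod_linear_factors:
  "order a (\<Prod>b\<leftarrow>bs. [:- b, 1:]) = count_list bs (a :: complex)"
proof (induction bs)
  case (Cons b bs)
  have nz: "[:- b, 1:] * (\<Prod>b\<leftarrow>bs. [:- b, 1:]) \<noteq> 0"
    unfolding mult_eq_0_iff by (auto simp: prod_list_zero_iff)
  have "order a [:- b, 1:] = (if b = a then 1 else 0)"
    using order_linear_power[of a "- b" 1] by auto
  then show ?case using Cons.IH order_mult[OF nz, of a] by simp
qed simp

lemma sum_count_list:
  fixes f :: "'a \<Rightarrow> real"
  shows "(\<Sum>x\<in>set xs. real (count_list xs x) * f x) = (\<Sum>x\<leftarrow>xs. f x)"
proof -
  \<comment> \<open>A fixed finite superset \<open>S\<close> keeps the index set constant during the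
    induction.\<close>
  have "(\<Sum>x\<leftarrow>xs. f x) = (\<Sum>x\<in>S. real (count_list xs x) * f x)"
    if "finite S" "set xs \<subseteq> S" for S
    using that(2)
  proof (induction xs)
    case (Cons y ys)
    have "(\<Sum>x\<in>S. real (count_list (y # ys) x) * f x)
        = (\<Sum>x\<in>S. (if x = y then f x else 0) + real (count_list ys x) * f x)"
      by (rule sum.cong) (auto simp: algebra_simps)
    then show ?case using Cons that(1) by (simp add: sum.distrib sum.delta)
  qed simp
  from this[of "set xs"] show ?thesis by simp
qed

text \<open>The case distinction of \<open>vn_entropy\<close> at 0 disappears because the factor
  \<open>Re a\<close> already annihilates the term.\<close>

lemma vn_entropy_linear_factors:
  assumes "char_poly A = (\<Prod>a\<leftarrow>as. [:- a, 1:])"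
  shows "vn_entropy d A = - (\<Sum>a\<leftarrow>as. Re a * log (real d) (Re a))"
proof -
  have "{ev. poly (char_poly A) ev = 0} = set as"
    unfolding assms by (induction as) auto
  then have "vn_entropy d A = - (\<Sum>ev\<in>set as. real (count_list as ev) * (Re ev * log (real d) (Re ev)))"
    unfolding vn_entropy_def assms order_prod_linear_factors by (auto intro!: sum.cong)
  then show ?thesis unfolding sum_count_list .
qed

lemma vn_entropy_diagonal:
  assumes D: "D \<in> carrier_mat n n" "diagonal_mat D"
  shows "vn_entropy d D = - (\<Sum>i<n. Re (D $$ (i, i)) * log (real d) (Re (D $$ (i, i))))"
proof -
  have "upper_triangular D" using D by (auto simp: upper_triangular_def diagonal_mat_def)
  from vn_entropy_linear_factors[OF char_poly_upper_triangular[OF D(1) this]]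
  show ?thesis using D(1)
    by (simp add: diag_mat_def o_def interv_sum_list_conv_sum_set_nat atLeast0LessThan)
qed

section \<open>Convexity of \<open>x ln x\<close>\<close>

text \<open>The graph lies above its tangent at \<open>a\<close>, by \<open>ln t \<le> t - 1\<close>
  at \<open>t = a / x\<close>. At \<open>x = 0\<close> the claim is
  \<open>- a \<le> 0\<close>.\<close>

lemma x_ln_x_tangent:
  fixes a x :: real
  assumes "a > 0" "x \<ge> 0"
  shows "a * ln a + (1 + ln a) * (x - a) \<le> x * ln x"
proof (cases "x = 0")
  case False
  then have x: "x > 0" using assms by simp
  have "ln (a / x) \<le> a / x - 1" using assms x by (intro ln_le_minus_one) simp
  then have "x * ln (a / x) \<le> x * (a / x - 1)" using x by (intro mult_left_mono) auto
  then have "x * (ln a - ln x) \<le> a - x" using assms x by (simp add: ln_div algebra_simps)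
  then show ?thesis by (simp add: algebra_simps)
qed (use assms in \<open>simp add: algebra_simps\<close>)

text \<open>Average the tangent inequality at the weighted mean \<open>a\<close>: the linear terms
  cancel because the weights sum to 1.\<close>

lemma x_ln_x_jensen:
  fixes w l :: "'a \<Rightarrow> real"
  assumes fin: "finite I" and w: "\<And>j. j \<in> I \<Longrightarrow> w j \<ge> 0" and w1: "sum w I = 1"
    and l: "\<And>j. j \<in> I \<Longrightarrow> l j \<ge> 0"
  shows "(\<Sum>j\<in>I. w j * l j) * ln (\<Sum>j\<in>I. w j * l j) \<le> (\<Sum>j\<in>I. w j * (l j * ln (l j)))"
proof -
  define a where "a = (\<Sum>j\<in>I. w j * l j)"
  have "a \<ge> 0" unfolding a_def using w l by (simp add: sum_nonneg)
  show ?thesis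
  proof (cases "a = 0")
    case True
    \<comment> \<open>There is no tangent at 0, but a vanishing mean of nonnegative terms forces
      every term to vanish.\<close>
    then have "w j * l j = 0" if "j \<in> I" for j
      using that w l fin unfolding a_def by (subst (asm) sum_nonneg_eq_0_iff) auto
    then have "(\<Sum>j\<in>I. w j * (l j * ln (l j))) = 0"
      by (intro sum.neutral) (auto simp flip: mult.assoc)
    then show ?thesis using True by (simp add: a_def)
  next
    case False
    with \<open>a \<ge> 0\<close> have a: "a > 0" by simp
    have "(\<Sum>j\<in>I. w j * (a * ln a + (1 + ln a) * (l j - a)))
        = (\<Sum>j\<in>I. w j * (- a) + (1 + ln a) * (w j * l j))"
      by (intro sum.cong refl) (simp add: algebra_simps)
    also have "\<dots> = sum w I * (- a) + (1 + ln a) * a"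
      unfolding sum.distrib sum_distrib_left[symmetric] sum_distrib_right[symmetric]
      by (simp add: a_def)
    also have "\<dots> = a * ln a" by (simp add: w1 algebra_simps)
    finally have "a * ln a = (\<Sum>j\<in>I. w j * (a * ln a + (1 + ln a) * (l j - a)))" ..
    also have "\<dots> \<le> (\<Sum>j\<in>I. w j * (l j * ln (l j)))"
      using w l x_ln_x_tangent[OF a] by (intro sum_mono mult_left_mono) auto
    finally show ?thesis by (simp add: a_def)
  qed
qed

text \<open>The Gram form \<open>psd\<close> provides both Hermiticity, hence a unitary
  diagonalization, and nonnegative eigenvalues, hence the domain on which \<open>x ln x\<close> is
  convex.\<close>

theorem vn_entropy_le_diagonal_part:
  fixes V :: "nat \<Rightarrow> 'e \<Rightarrow> complex"
  assumes d: "d \<ge> 2" and A: "A \<in> carrier_mat n n" and B: "B \<in> carrier_mat n n"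
    and psd: "\<And>i j. i < n \<Longrightarrow> j < n \<Longrightarrow> A $$ (i, j) = (\<Sum>e\<in>E. V i e * cnj (V j e))"
    and diag: "diagonal_mat B" and BA: "\<And>i. i < n \<Longrightarrow> B $$ (i, i) = A $$ (i, i)"
  shows "vn_entropy d A \<le> vn_entropy d B"
proof -
  have herm: "adj A = A"
    using A by (intro eq_matI) (auto simp: psd mult.commute)
  obtain U D where U: "U \<in> carrier_mat n n" and D: "D \<in> carrier_mat n n"
    and UU: "adj U * U = 1\<^sub>m n" and dD: "diagonal_mat D" and AUD: "A = U * D * adj U"
    using hermitian_diagonalization[OF A herm] by blast
  have aU: "adj U \<in> carrier_mat n n" using U by simp
  have UU': "U * adj U = 1\<^sub>m n" using mat_mult_left_right_inverse[OF aU U UU] .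
  have "similar_mat A D"
    using A U D aU UU UU' AUD by (intro similar_matI[of _ _ U "adj U" n]) auto
  then have entA: "vn_entropy d A = vn_entropy d D"
    unfolding vn_entropy_def by (simp add: char_poly_similar)
  have DUA: "D = adj U * A * U"
  proof -
    have "adj U * A * U = (adj U * U) * D * (adj U * U)"
      unfolding AUD using U D aU by (smt (verit) assoc_mult_mat mult_carrier_mat)
    then show ?thesis using D unfolding UU by simp
  qed
  \<comment> \<open>An eigenvalue is the quadratic form of \<open>A\<close> at a column of
    \<open>U\<close>; the Gram form turns it into a sum of squares.\<close>
  have Djj: "D $$ (j, j) = of_real (\<Sum>e\<in>E. (cmod (\<Sum>i<n. cnj (U $$ (i, j)) * V i e))\<^sup>2)"
    if j: "j < n" for j
  proof -
    have "D $$ (j, j) = (\<Sum>k<n. (adj U * A) $$ (j, k) * U $$ (k, j))"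
      unfolding DUA using U A aU j by (intro index_mult_sum) auto
    also have "\<dots> = (\<Sum>k<n. (\<Sum>i<n. cnj (U $$ (i, j)) * A $$ (i, k)) * U $$ (k, j))"
      using U A aU j by (intro sum.cong refl) (subst index_mult_sum[OF aU A], auto)
    also have "\<dots> = (\<Sum>k<n. \<Sum>i<n. \<Sum>e\<in>E. cnj (U $$ (i, j)) * V i e * cnj (cnj (U $$ (k, j)) * V k e))"
      by (intro sum.cong refl) (simp add: psd sum_distrib_left sum_distrib_right mult_ac)
    also have "\<dots> = (\<Sum>e\<in>E. \<Sum>k<n. \<Sum>i<n. cnj (U $$ (i, j)) * V i e * cnj (cnj (U $$ (k, j)) * V k e))"
      by (subst sum.swap[of _ E]) (intro sum.cong refl sum.swap)
    also have "\<dots> = (\<Sum>e\<in>E. (\<Sum>i<n. cnj (U $$ (i, j)) * V i e) * cnj (\<Sum>k<n. cnj (U $$ (k, j)) * V k e))"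
      unfolding cnj_sum sum_product by (subst sum.swap) (rule refl)
    finally show ?thesis by (simp add: complex_norm_square del: of_real_power)
  qed
  define l where "l j = Re (D $$ (j, j))" for j
  \<comment> \<open>These weights are doubly stochastic since \<open>U\<close> is unitary. Row sums
    justify Jensen for each diagonal entry; column sums then recover the sum over the
    spectrum.\<close>
  define w where "w i j = (cmod (U $$ (i, j)))\<^sup>2" for i j
  have l0: "l j \<ge> 0" if "j < n" for j using that by (simp add: l_def Djj sum_nonneg)
  have Dl: "D $$ (j, j) = of_real (l j)" if "j < n" for j using that by (simp add: l_def Djj)
  have row: "(\<Sum>j<n. w i j) = 1" if i: "i < n" for i
  proof -
    have "complex_of_real (\<Sum>j<n. w i j) = (\<Sum>j<n. U $$ (i, j) * adj U $$ (j, i))"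
      using U i by (auto simp: w_def complex_norm_square simp del: of_real_power intro!: sum.cong)
    also have "\<dots> = 1\<^sub>m n $$ (i, i)"
      unfolding UU'[symmetric] using U aU i by (intro index_mult_sum[symmetric]) auto
    finally show ?thesis using i by (simp del: of_real_sum)
  qed
  have col: "(\<Sum>i<n. w i j) = 1" if j: "j < n" for j
  proof -
    have "complex_of_real (\<Sum>i<n. w i j) = (\<Sum>i<n. adj U $$ (j, i) * U $$ (i, j))"
      using U j by (auto simp: w_def complex_norm_square mult.commute simp del: of_real_power intro!: sum.cong)
    also have "\<dots> = 1\<^sub>m n $$ (j, j)"
      unfolding UU[symmetric] using U aU j by (intro index_mult_sum[symmetric]) auto
    finally show ?thesis using j by (simp del: of_real_sum)
  qed
  have Aii: "Re (A $$ (i, i)) = (\<Sum>j<n. w i j * l j)" if i: "i < n" for i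
  proof -
    have "A $$ (i, i) = (\<Sum>j<n. (U * D) $$ (i, j) * adj U $$ (j, i))"
      unfolding AUD using U D aU i by (intro index_mult_sum) auto
    also have "\<dots> = (\<Sum>j<n. of_real (w i j * l j))"
    proof (intro sum.cong refl)
      fix j assume "j \<in> {..<n}"
      then have j: "j < n" by simp
      have "(U * D) $$ (i, j) = (\<Sum>k<n. U $$ (i, k) * D $$ (k, j))"
        using U D i j by (intro index_mult_sum) auto
      also have "\<dots> = (\<Sum>k<n. if k = j then U $$ (i, j) * of_real (l j) else 0)"
        using dD D j by (intro sum.cong refl) (auto simp: diagonal_mat_def Dl)
      also have "\<dots> = U $$ (i, j) * of_real (l j)" using j by simp
      finally show "(U * D) $$ (i, j) * adj U $$ (j, i) = of_real (w i j * l j)"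
        using U i j by (simp add: w_def complex_norm_square del: of_real_power)
    qed
    finally show ?thesis by simp
  qed
  have "(\<Sum>i<n. Re (B $$ (i, i)) * ln (Re (B $$ (i, i))))
      = (\<Sum>i<n. (\<Sum>j<n. w i j * l j) * ln (\<Sum>j<n. w i j * l j))"
    by (intro sum.cong refl) (simp add: BA Aii)
  also have "\<dots> \<le> (\<Sum>i<n. \<Sum>j<n. w i j * (l j * ln (l j)))"
    using row l0 by (intro sum_mono x_ln_x_jensen) (auto simp: w_def)
  also have "\<dots> = (\<Sum>j<n. (\<Sum>i<n. w i j) * (l j * ln (l j)))"
    unfolding sum_distrib_right by (rule sum.swap)
  also have "\<dots> = (\<Sum>j<n. l j * ln (l j))" by (simp add: col)
  \<comment> \<open>Division by \<open>ln d\<close>, positive as \<open>d \<ge> 2\<close>, converts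
    to logarithms to base \<open>d\<close>.\<close>
  finally have "(\<Sum>i<n. Re (B $$ (i, i)) * ln (Re (B $$ (i, i)))) / ln d
      \<le> (\<Sum>j<n. l j * ln (l j)) / ln d"
    using d by (intro divide_right_mono) auto
  then show ?thesis
    unfolding entA vn_entropy_diagonal[OF D dD] vn_entropy_diagonal[OF B diag]
    by (simp add: l_def log_def sum_divide_distrib)
qed

section \<open>Reduced states of measured and amplified systems\<close>

lemma finite_tuples [simp]: "finite (tuples d m)"
  unfolding tuples_def using finite_lists_length_eq[of "{..<d}" m]
  by (simp add: conj_commute)

lemma length_tuples: "x \<in> tuples d m \<Longrightarrow> length x = m"
  by (simp add: tuples_def)

lemma nth_tuples: "x \<in> tuples d m \<Longrightarrow> p < m \<Longrightarrow> x ! p < d"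
  using nth_mem[of p x] by (simp add: tuples_def subset_iff)

lemma tuples_update: "x \<in> tuples d m \<Longrightarrow> q < d \<Longrightarrow> x[p := q] \<in> tuples d m"
  using set_update_subset_insert[of x p q] by (auto simp: tuples_def)

lemma tuples_eqI:
  "x \<in> tuples d m \<Longrightarrow> y \<in> tuples d m \<Longrightarrow> (\<And>p. p < m \<Longrightarrow> x ! p = y ! p) \<Longrightarrow> x = y"
  by (rule nth_equalityI) (auto simp: tuples_def)

lemma sum_tuples_update:
  fixes f :: "nat list \<Rightarrow> complex"
  assumes p: "p < m"
  shows "(\<Sum>x\<in>tuples d m. \<Sum>q<d. f (x[p := q])) = of_nat d * (\<Sum>x\<in>tuples d m. f x)"
proof -
  have "(\<Sum>x\<in>tuples d m. \<Sum>q<d. f (x[p := q])) = (\<Sum>(x, q)\<in>tuples d m \<times> {..<d}. f (x[p := q]))"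
    by (simp add: sum.cartesian_product)
  also have "\<dots> = (\<Sum>(x, q)\<in>tuples d m \<times> {..<d}. f x)"
    \<comment> \<open>Exchanging entry \<open>p\<close> of the tuple with the free digit
      \<open>q\<close> is an involution on the pairs, hence its own inverse.\<close>
    by (rule sum.reindex_bij_witness[where i = "\<lambda>(x, q). (x[p := q], x ! p)"
          and j = "\<lambda>(x, q). (x[p := q], x ! p)"])
      (use p in \<open>auto simp: tuples_update nth_tuples length_tuples\<close>)
  also have "\<dots> = of_nat d * (\<Sum>x\<in>tuples d m. f x)"
    by (simp flip: sum.cartesian_product add: sum_distrib_left)
  finally show ?thesis .
qed

text \<open>Serves to trace out position \<open>p\<close> without splitting the tuples: it suffices
  that the sum over this entry vanishes with the others held fixed.\<close>

lemma sum_tuples_eq_0: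
  fixes f :: "nat list \<Rightarrow> complex"
  assumes "p < m" and d: "d > 0" and "(\<Sum>x\<in>tuples d m. \<Sum>q<d. f (x[p := q])) = 0"
  shows "(\<Sum>x\<in>tuples d m. f x) = 0"
  using assms sum_tuples_update[of p m f d] by simp

section \<open>Reduced density matrices of pure states\<close>

text \<open>A partial trace is a sum of rank-one terms, one for each configuration \<open>e\<close>
  of the environment; \<open>V i e\<close> is the amplitude of \<open>i\<close> on \<open>K\<close>
  together with \<open>e\<close> elsewhere.\<close>

lemma rdm_gram:
  "\<exists>(E :: nat list set) V. \<forall>i j. rdm d m psi K i j = (\<Sum>e\<in>E. V i e * cnj (V j e))"
proof -
  \<comment> \<open>Positions in \<open>K\<close> are blanked by 0, so that equality of
    \<open>env\<close> means agreement outside \<open>K\<close>.\<close>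
  define env where "env x = map (\<lambda>p. if p \<in> set K then 0 else x ! p) [0..<m]" for x :: "nat list"
  let ?T = "tuples d m"
  let ?P = "\<lambda>k e x. if map ((!) x) K = k \<and> env x = e then psi x else 0"
  have env_eq: "env x = env y \<longleftrightarrow> (\<forall>p<m. p \<notin> set K \<longrightarrow> x ! p = y ! p)" for x y
    unfolding env_def by auto
  have "rdm d m psi K i j = (\<Sum>e\<in>env ` ?T. (\<Sum>x\<in>?T. ?P i e x) * cnj (\<Sum>x\<in>?T. ?P j e x))" for i j
  proof -
    have "(\<Sum>e\<in>env ` ?T. (\<Sum>x\<in>?T. ?P i e x) * cnj (\<Sum>x\<in>?T. ?P j e x))
        = (\<Sum>e\<in>env ` ?T. \<Sum>x\<in>?T. \<Sum>y\<in>?T. ?P i e x * cnj (?P j e y))"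
      unfolding cnj_sum sum_product ..
    also have "\<dots> = (\<Sum>x\<in>?T. \<Sum>e\<in>env ` ?T. \<Sum>y\<in>?T. ?P i e x * cnj (?P j e y))"
      by (rule sum.swap)
    also have "\<dots> = (\<Sum>x\<in>?T. \<Sum>y\<in>?T. \<Sum>e\<in>env ` ?T. ?P i e x * cnj (?P j e y))"
      by (intro sum.cong refl sum.swap)
    also have "\<dots> = (\<Sum>x\<in>?T. \<Sum>y\<in>?T. \<Sum>e\<in>env ` ?T. if e = env x then
        (if map ((!) x) K = i \<and> map ((!) y) K = j \<and> env x = env y
         then psi x * cnj (psi y) else 0) else 0)"
      by (intro sum.cong refl) auto
    also have "\<dots> = rdm d m psi K i j"
      unfolding rdm_def by (intro sum.cong refl) (auto simp: env_eq)
    finally show ?thesis ..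
  qed
  then show ?thesis by (intro exI allI)
qed

text \<open>The inner sum collapses: the only tuple with entry \<open>j\<close> at \<open>k\<close>
  that agrees with \<open>x\<close> elsewhere is \<open>x[k := j]\<close>.\<close>

lemma rdm_single:
  assumes k: "k < m" and j: "j < d"
  shows "rdm d m psi [k] [i] [j]
    = (\<Sum>x\<in>tuples d m. if x ! k = i then psi x * cnj (psi (x[k := j])) else 0)"
  unfolding rdm_def
proof (intro sum.cong refl)
  fix x assume x: "x \<in> tuples d m"
  have "(\<Sum>y\<in>tuples d m. if map ((!) x) [k] = [i] \<and> map ((!) y) [k] = [j] \<and>
          (\<forall>p<m. p \<notin> set [k] \<longrightarrow> x ! p = y ! p) then psi x * cnj (psi y) else 0)
      = (\<Sum>y\<in>tuples d m. if y = x[k := j] then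
          (if x ! k = i then psi x * cnj (psi (x[k := j])) else 0) else 0)"
  proof (intro sum.cong refl)
    fix y assume y: "y \<in> tuples d m"
    have "(y ! k = j \<and> (\<forall>p<m. p \<noteq> k \<longrightarrow> x ! p = y ! p)) \<longleftrightarrow> y = x[k := j]"
    proof
      assume "y ! k = j \<and> (\<forall>p<m. p \<noteq> k \<longrightarrow> x ! p = y ! p)"
      then show "y = x[k := j]"
        using k length_tuples[OF x]
        by (intro tuples_eqI[OF y tuples_update[OF x j]]) (auto simp: nth_list_update)
    qed (use k length_tuples[OF x] in simp)
    then show "(if map ((!) x) [k] = [i] \<and> map ((!) y) [k] = [j] \<and>
          (\<forall>p<m. p \<notin> set [k] \<longrightarrow> x ! p = y ! p) then psi x * cnj (psi y) else 0)
        = (if y = x[k := j] then (if x ! k = i then psi x * cnj (psi (x[k := j])) else 0) else 0)"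
      by auto
  qed
  also have "\<dots> = (if x ! k = i then psi x * cnj (psi (x[k := j])) else 0)"
    using tuples_update[OF x j, of k] by simp
  finally show "(\<Sum>y\<in>tuples d m. if map ((!) x) [k] = [i] \<and> map ((!) y) [k] = [j] \<and>
          (\<forall>p<m. p \<notin> set [k] \<longrightarrow> x ! p = y ! p) then psi x * cnj (psi y) else 0)
      = (if x ! k = i then psi x * cnj (psi (x[k := j])) else 0)" .
qed

text \<open>Tuples that agree both on and off \<open>K\<close> coincide, so only the terms with
  \<open>y = x\<close> survive.\<close>

lemma rdm_diagonal:
  "rdm d m psi K i i = (\<Sum>x\<in>tuples d m. if map ((!) x) K = i then psi x * cnj (psi x) else 0)"
  unfolding rdm_def
proof (intro sum.cong refl)
  fix x assume x: "x \<in> tuples d m"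
  have "(\<Sum>y\<in>tuples d m. if map ((!) x) K = i \<and> map ((!) y) K = i \<and>
          (\<forall>p<m. p \<notin> set K \<longrightarrow> x ! p = y ! p) then psi x * cnj (psi y) else 0)
      = (\<Sum>y\<in>tuples d m. if y = x then
          (if map ((!) x) K = i then psi x * cnj (psi x) else 0) else 0)"
  proof (intro sum.cong refl)
    fix y assume y: "y \<in> tuples d m"
    have "y = x" if "map ((!) x) K = i" "map ((!) y) K = i" "\<forall>p<m. p \<notin> set K \<longrightarrow> x ! p = y ! p"
    proof (rule tuples_eqI[OF y x])
      fix p assume "p < m"
      show "y ! p = x ! p"
      proof (cases "p \<in> set K")
        case True
        have "map ((!) y) K = map ((!) x) K" using that by simp
        with True show ?thesis by simp
      qed (use that \<open>p < m\<close> in auto)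
    qed
    then show "(if map ((!) x) K = i \<and> map ((!) y) K = i \<and>
          (\<forall>p<m. p \<notin> set K \<longrightarrow> x ! p = y ! p) then psi x * cnj (psi y) else 0)
        = (if y = x then (if map ((!) x) K = i then psi x * cnj (psi x) else 0) else 0)"
      by auto
  qed
  also have "\<dots> = (if map ((!) x) K = i then psi x * cnj (psi x) else 0)"
    using x by simp
  finally show "(\<Sum>y\<in>tuples d m. if map ((!) x) K = i \<and> map ((!) y) K = i \<and>
          (\<forall>p<m. p \<notin> set K \<longrightarrow> x ! p = y ! p) then psi x * cnj (psi y) else 0)
      = (if map ((!) x) K = i then psi x * cnj (psi x) else 0)" .
qed

section \<open>Orthonormal bases\<close>

definition orthonormal_basis :: "nat \<Rightarrow> (nat \<Rightarrow> nat \<Rightarrow> complex) \<Rightarrow> bool" where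
  "orthonormal_basis d v \<longleftrightarrow>
     (\<forall>x<d. \<forall>y<d. (\<Sum>q<d. cnj (v x q) * v y q) = (if x = y then 1 else 0))"

text \<open>Orthonormality of \<open>d\<close> vectors says that a square matrix has a one-sided
  inverse; that inverse is two-sided.\<close>

lemma orthonormal_basis_complete:
  assumes v: "orthonormal_basis d v" and "q < d" "r < d"
  shows "(\<Sum>x<d. v x q * cnj (v x r)) = (if q = r then 1 else 0)"
proof -
  define M where "M = mat d d (\<lambda>(x, q). cnj (v x q))"
  define N where "N = mat d d (\<lambda>(q, x). v x q)"
  have M: "M \<in> carrier_mat d d" and N: "N \<in> carrier_mat d d" by (auto simp: M_def N_def)
  have "M * N = 1\<^sub>m d"
    using v by (intro eq_matI)
      (auto simp: M_def N_def scalar_prod_def atLeast0LessThan orthonormal_basis_def)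
  then have "N * M = 1\<^sub>m d" by (rule mat_mult_left_right_inverse[OF M N])
  then have "(N * M) $$ (q, r) = 1\<^sub>m d $$ (q, r)" by simp
  then show ?thesis using assms(2,3)
    by (simp add: M_def N_def scalar_prod_def atLeast0LessThan)
qed

text \<open>Expand both products and sum over \<open>r\<close> first; completeness leaves only the
  terms with \<open>s = q\<close>.\<close>

lemma orthonormal_basis_parseval:
  assumes v: "orthonormal_basis d v"
  shows "(\<Sum>r<d. (\<Sum>q<d. cnj (v r q) * f q) * cnj (\<Sum>q<d. cnj (v r q) * g q))
    = (\<Sum>q<d. f q * cnj (g q))"
proof -
  have "(\<Sum>r<d. (\<Sum>q<d. cnj (v r q) * f q) * cnj (\<Sum>q<d. cnj (v r q) * g q))
      = (\<Sum>r<d. \<Sum>q<d. \<Sum>s<d. f q * cnj (g s) * (v r s * cnj (v r q)))"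
    unfolding cnj_sum sum_product by (intro sum.cong refl) (simp add: mult_ac)
  also have "\<dots> = (\<Sum>q<d. \<Sum>r<d. \<Sum>s<d. f q * cnj (g s) * (v r s * cnj (v r q)))"
    by (rule sum.swap)
  also have "\<dots> = (\<Sum>q<d. \<Sum>s<d. \<Sum>r<d. f q * cnj (g s) * (v r s * cnj (v r q)))"
    by (intro sum.cong refl sum.swap)
  also have "\<dots> = (\<Sum>q<d. \<Sum>s<d. if s = q then f q * cnj (g q) else 0)"
    unfolding sum_distrib_left[symmetric]
    by (intro sum.cong refl) (auto simp: orthonormal_basis_complete[OF v])
  finally show ?thesis by simp
qed

lemma orthonormal_basis_cnj:
  assumes "orthonormal_basis d v" "x < d" "y < d" "x \<noteq> y"
  shows "(\<Sum>q<d. v x q * cnj (v y q)) = 0"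
proof -
  have "(\<Sum>q<d. cnj (v y q) * v x q) = 0"
    using assms by (auto simp: orthonormal_basis_def)
  then show ?thesis by (simp add: mult.commute)
qed

section \<open>Single ancillae are diagonal\<close>

text \<open>A measurement leaves \<open>Q\<close>, at position 0, in a basis vector determined by
  the outcome, so the dependence on \<open>q\<close> splits off as one factor.\<close>

lemma measure_step_update:
  assumes "x \<in> tuples d m" "q < d" "0 < i" "0 < m"
  shows "measure_step d m b i psi (x[0 := q])
    = b i (x ! i) q * (\<Sum>s<d. cnj (b i (x ! i) s) * psi (x[0 := s, i := 0]))"
  using assms tuples_update[of x d m q 0] length_tuples[of x d m]
  by (simp add: measure_step_def)

text \<open>Different outcomes leave \<open>Q\<close> in orthogonal vectors, and tracing out
  \<open>Q\<close> produces their inner product.\<close>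

lemma rdm_measure_step_diagonal:
  assumes v: "orthonormal_basis d (b k)" and k: "0 < k" "k < m" and ij: "i < d" "j < d" "i \<noteq> j"
  shows "rdm d m (measure_step d m b k psi) [k] [i] [j] = 0"
  unfolding rdm_single[OF k(2) ij(2)]
proof (rule sum_tuples_eq_0[of 0], goal_cases)
  case 3
  show ?case
  proof (rule sum.neutral, rule ballI)
    fix x assume x: "x \<in> tuples d m"
    let ?G = "\<lambda>i x. \<Sum>s<d. cnj (b k i s) * psi (x[0 := s, k := 0])"
    let ?F = "measure_step d m b k psi"
    have "(\<Sum>q<d. if x[0 := q] ! k = i then ?F (x[0 := q]) * cnj (?F (x[0 := q, k := j])) else 0)
        = (\<Sum>q<d. if x ! k = i then ?G i x * cnj (?G j x) * (b k i q * cnj (b k j q)) else 0)"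
    proof (intro sum.cong refl)
      fix q assume "q \<in> {..<d}"
      then have q: "q < d" by simp
      have 1: "?F (x[0 := q]) = b k (x ! k) q * ?G (x ! k) x"
        using x q k by (simp add: measure_step_update)
      have "?F (x[0 := q, k := j]) = ?F (x[k := j, 0 := q])"
        using k by (simp add: list_update_swap)
      also have "\<dots> = b k j q * ?G j (x[k := j])"
        using measure_step_update[OF tuples_update[OF x ij(2), of k] q k(1), of b psi] k length_tuples[OF x]
        by simp
      \<comment> \<open>\<open>psi\<close> is evaluated with entry \<open>k\<close> reset to 0, so
        the update to \<open>j\<close> is overwritten.\<close>
      also have "?G j (x[k := j]) = ?G j x"
        using k by (intro sum.cong refl) (simp add: list_update_swap[of 0 k])
      finally show "(if x[0 := q] ! k = i then ?F (x[0 := q]) * cnj (?F (x[0 := q, k := j])) else 0)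
          = (if x ! k = i then ?G i x * cnj (?G j x) * (b k i q * cnj (b k j q)) else 0)"
        using 1 k by simp
    qed
    also have "\<dots> = 0"
      using orthonormal_basis_cnj[OF v ij]
      by (cases "x ! k = i") (simp_all add: sum_distrib_left[symmetric] del: cnj_sum)
    finally show "(\<Sum>q<d. if x[0 := q] ! k = i then ?F (x[0 := q]) * cnj (?F (x[0 := q, k := j])) else 0) = 0" .
  qed
qed (use k ij in auto)

text \<open>Tracing out \<open>Q\<close> removes the normalized vectors of the later basis; tracing
  out \<open>l\<close> then sums products of overlaps, which Parseval turns back into an inner
  product of earlier basis vectors.\<close>

lemma rdm_measure_step_twice_diagonal:
  assumes v: "orthonormal_basis d (b k)" and w: "orthonormal_basis d (b l)"
    and k: "0 < k" "k < m" and l: "0 < l" "l < m" "l \<noteq> k" and ij: "i < d" "j < d" "i \<noteq> j"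
  shows "rdm d m (measure_step d m b l (measure_step d m b k psi)) [k] [i] [j] = 0"
proof -
  let ?P = "measure_step d m b k psi"
  let ?F = "measure_step d m b l ?P"
  let ?f = "\<lambda>x. if x ! k = i then ?F x * cnj (?F (x[k := j])) else 0"
  have upd: "?F (x[0 := q, l := r])
      = b l r q * ((\<Sum>s<d. cnj (b l r s) * b k (x ! k) s) *
          (\<Sum>s<d. cnj (b k (x ! k) s) * psi (x[0 := s, l := 0, k := 0])))"
    if x: "x \<in> tuples d m" and q: "q < d" and r: "r < d" for x q r
  proof -
    have "?F (x[0 := q, l := r]) = ?F (x[l := r, 0 := q])"
      using l by (simp add: list_update_swap)
    also have "\<dots> = b l r q * (\<Sum>s<d. cnj (b l r s) * ?P (x[l := r, 0 := s, l := 0]))"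
      using measure_step_update[OF tuples_update[OF x r, of l] q l(1), of b ?P] l length_tuples[OF x]
      by simp
    also have "(\<Sum>s<d. cnj (b l r s) * ?P (x[l := r, 0 := s, l := 0]))
        = (\<Sum>s<d. cnj (b l r s) * (b k (x ! k) s *
            (\<Sum>s<d. cnj (b k (x ! k) s) * psi (x[0 := s, l := 0, k := 0]))))"
    proof (intro sum.cong refl)
      fix s assume "s \<in> {..<d}"
      then have s: "s < d" by simp
      have "?P (x[l := r, 0 := s, l := 0]) = ?P (x[l := 0, 0 := s])"
        using l by (simp add: list_update_swap[of 0 l])
      also have "\<dots> = b k (x ! k) s * (\<Sum>s<d. cnj (b k (x ! k) s) * psi (x[l := 0, 0 := s, k := 0]))"
        using measure_step_update[OF tuples_update[OF x, of 0 l] s k(1), of b psi] l k ij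
        by simp
      finally show "cnj (b l r s) * ?P (x[l := r, 0 := s, l := 0]) = cnj (b l r s) * (b k (x ! k) s *
            (\<Sum>s<d. cnj (b k (x ! k) s) * psi (x[0 := s, l := 0, k := 0])))"
        using l by (simp add: list_update_swap[of 0 l])
    qed
    finally show ?thesis by (simp add: sum_distrib_right mult.assoc)
  qed
  have main: "(\<Sum>q<d. \<Sum>r<d. ?f (x[0 := q, l := r])) = 0" if x: "x \<in> tuples d m" for x
  proof (cases "x ! k = i")
    case True
    \<comment> \<open>\<open>h\<close> is the amplitude before the later measurement, free of
      \<open>q\<close> and \<open>r\<close>; \<open>c i r\<close> is the overlap of the later vector
      \<open>r\<close> with the earlier vector \<open>i\<close>.\<close>
    define h where "h y = (\<Sum>s<d. cnj (b k (y ! k) s) * psi (y[0 := s, l := 0, k := 0]))" for y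
    define c where "c i r = (\<Sum>s<d. cnj (b l r s) * b k i s)" for i r
    let ?y = "x[k := j]"
    have y: "?y \<in> tuples d m" using x ij by (simp add: tuples_update)
    have "?f (x[0 := q, l := r])
        = h x * cnj (h ?y) * (c i r * cnj (c j r) * (cnj (b l r q) * b l r q))"
      if qr: "q < d" "r < d" for q r
    proof -
      have 1: "?F (x[0 := q, l := r]) = b l r q * (c i r * h x)"
        using upd[OF x qr] True by (simp add: c_def h_def)
      have "?F (x[0 := q, l := r, k := j]) = ?F (?y[0 := q, l := r])"
        using l k by (simp add: list_update_swap[of _ k])
      also have "\<dots> = b l r q * (c j r * h ?y)"
        using upd[OF y qr] k length_tuples[OF x] by (simp add: c_def h_def)
      finally show ?thesis using 1 True k l by simp
    qed
    then have "(\<Sum>q<d. \<Sum>r<d. ?f (x[0 := q, l := r]))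
        = (\<Sum>q<d. \<Sum>r<d. h x * cnj (h ?y) * (c i r * cnj (c j r) * (cnj (b l r q) * b l r q)))"
      by simp
    also have "\<dots> = (\<Sum>r<d. \<Sum>q<d. h x * cnj (h ?y) * (c i r * cnj (c j r) * (cnj (b l r q) * b l r q)))"
      by (rule sum.swap)
    also have "\<dots> = h x * cnj (h ?y) * (\<Sum>r<d. c i r * cnj (c j r))"
      using w unfolding sum_distrib_left[symmetric]
      by (simp add: orthonormal_basis_def)
    also have "(\<Sum>r<d. c i r * cnj (c j r)) = (\<Sum>q<d. b k i q * cnj (b k j q))"
      unfolding c_def by (rule orthonormal_basis_parseval[OF w])
    also have "\<dots> = 0" by (rule orthonormal_basis_cnj[OF v ij])
    finally show ?thesis by simp
  qed (use k l in simp)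
  have "(\<Sum>x\<in>tuples d m. ?f x) = 0"
  proof (rule sum_tuples_eq_0[of l])
    show "(\<Sum>x\<in>tuples d m. \<Sum>r<d. ?f (x[l := r])) = 0"
    proof (rule sum_tuples_eq_0[of 0])
      show "(\<Sum>x\<in>tuples d m. \<Sum>q<d. \<Sum>r<d. ?f (x[0 := q, l := r])) = 0"
        using main by (intro sum.neutral) blast
    qed (use k ij in auto)
  qed (use l ij in auto)
  then show ?thesis unfolding rdm_single[OF k(2) ij(2)] .
qed

section \<open>Amplification as dephasing\<close>

text \<open>Stopping after \<open>k\<close> copies gives the induction its invariant: detectors up
  to \<open>k\<close> repeat their ancillae, and the later ones are still blank.\<close>

lemma foldl_copy_step:
  assumes d: "d > 0"
  shows "k \<le> n \<Longrightarrow> foldl (\<lambda>psi i. copy_step d n i psi) (add_detectors d n psi) [1..<k + 1] ys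
    = (if ys \<in> tuples d (2 * n + 1) \<and> (\<forall>i\<in>{1..k}. ys ! (n + i) = ys ! i) \<and>
          (\<forall>i\<in>{k<..n}. ys ! (n + i) = 0)
       then psi (take (n + 1) ys) else 0)"
proof (induction k arbitrary: ys)
  case 0
  have "{1..n} = {0<..n}" by auto
  then show ?case by (simp add: add_detectors_def)
next
  case (Suc k)
  let ?f = "\<lambda>k. foldl (\<lambda>psi i. copy_step d n i psi) (add_detectors d n psi) [1..<k + 1]"
  let ?z = "ys[n + Suc k := 0]"
  have step: "?f (Suc k) ys = (if ys \<in> tuples d (2 * n + 1) \<and> ys ! (n + Suc k) = ys ! Suc k
      then ?f k ?z else 0)"
    by (simp add: copy_step_def)
  show ?case
  proof (cases "ys \<in> tuples d (2 * n + 1)")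
    case True
    note len = length_tuples[OF True]
    have z: "?z \<in> tuples d (2 * n + 1)" using True d by (rule tuples_update)
    \<comment> \<open>Entry \<open>n + Suc k\<close> lies just beyond the prefix of \<open>Q\<close>
      and the ancillae, even for \<open>k = 0\<close>.\<close>
    have "take (n + 1) ?z = take (n + 1) ys" by simp
    moreover have "(\<forall>i\<in>{1..k}. ?z ! (n + i) = ?z ! i) \<longleftrightarrow> (\<forall>i\<in>{1..k}. ys ! (n + i) = ys ! i)"
      using Suc.prems by (intro ball_cong refl) simp
    \<comment> \<open>The reset entry meets the blankness condition at \<open>Suc k\<close>, which
      therefore drops out.\<close>
    moreover have "(\<forall>i\<in>{k<..n}. ?z ! (n + i) = 0) \<longleftrightarrow> (\<forall>i\<in>{Suc k<..n}. ys ! (n + i) = 0)"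
    proof -
      have "{k<..n} = insert (Suc k) {Suc k<..n}" using Suc.prems by auto
      then show ?thesis using len Suc.prems by (auto simp: nth_list_update)
    qed
    moreover have "{1..Suc k} = insert (Suc k) {1..k}" by auto
    ultimately show ?thesis
      unfolding step using Suc.IH[of ?z] Suc.prems True z by auto
  qed (use step in simp)
qed

lemma amplified_eq:
  assumes "d > 0"
  shows "amplified d n b alpha ys
    = (if ys \<in> tuples d (2 * n + 1) \<and> (\<forall>i\<in>{1..n}. ys ! (n + i) = ys ! i)
       then unamplified d n b alpha (take (n + 1) ys) else 0)"
  unfolding amplified_def foldl_copy_step[OF assms order_refl] by simp

text \<open>The environment of the detectors contains all ancillae and so fixes every detector
  value, which kills the off-diagonal entries. Diagonal entries are outcome probabilities, unchanged
  by copying.\<close>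

lemma rdm_amplified:
  assumes d: "d > 0" and K: "set K \<subseteq> {1..n}"
  shows "rdm d (2 * n + 1) (amplified d n b alpha) (map ((+) n) K) i j
    = (if i = j then rdm d (n + 1) (unamplified d n b alpha) K i i else 0)"
proof -
  let ?T = "tuples d (2 * n + 1)"
  let ?A = "amplified d n b alpha" and ?U = "unamplified d n b alpha"
  let ?K = "map ((+) n) K"
  have coincide: "y = y'" if nz: "?A y \<noteq> 0" "?A y' \<noteq> 0"
    and agree: "\<forall>p<2 * n + 1. p \<notin> set ?K \<longrightarrow> y ! p = y' ! p" for y y'
  proof (rule tuples_eqI)
    show T: "y \<in> ?T" "y' \<in> ?T" using nz by (auto simp: amplified_eq[OF d] split: if_splits)
    have low: "y ! p = y' ! p" if "p \<le> n" for p
    proof -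
      have "p \<notin> set ?K" using K that by fastforce
      then show ?thesis using agree that by auto
    qed
    fix p assume p: "p < 2 * n + 1"
    show "y ! p = y' ! p"
    proof (cases "p \<le> n")
      case False
      then obtain i where i: "p = n + i" "i \<in> {1..n}"
        using p by (intro that[of "p - n"]) auto
      have "y ! p = y ! i" "y' ! p = y' ! i"
        using nz i by (auto simp: amplified_eq[OF d] split: if_splits)
      then show ?thesis using low[of i] i by simp
    qed (rule low)
  qed
  have "rdm d (2 * n + 1) ?A ?K i j
      = (if i = j then rdm d (2 * n + 1) ?A ?K i i else 0)"
  proof (cases "i = j")
    case False
    have "(if map ((!) y) ?K = i \<and> map ((!) y') ?K = j \<and>
        (\<forall>p<2 * n + 1. p \<notin> set ?K \<longrightarrow> y ! p = y' ! p) then ?A y * cnj (?A y') else 0) = 0" for y y'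
      using coincide[of y y'] False by (cases "?A y = 0 \<or> ?A y' = 0") (simp, metis)
    then show ?thesis unfolding rdm_def using False by simp
  qed simp
  moreover have "rdm d (2 * n + 1) ?A ?K i i = rdm d (n + 1) ?U K i i"
  proof -
    \<comment> \<open>\<open>tl\<close> skips \<open>Q\<close>, which has no detector;
      \<open>?D\<close> maps the unamplified tuples onto those satisfying the copy
      condition.\<close>
    let ?D = "\<lambda>x. x @ tl x"
    have mem: "?D x \<in> ?T" "\<forall>i\<in>{1..n}. ?D x ! (n + i) = ?D x ! i" "take (n + 1) (?D x) = x"
      if "x \<in> tuples d (n + 1)" for x
    proof -
      have len: "length x = n + 1" using that by (rule length_tuples)
      show "?D x \<in> ?T" using that by (cases x) (auto simp: tuples_def)
      show "\<forall>i\<in>{1..n}. ?D x ! (n + i) = ?D x ! i"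
        using len by (auto simp: nth_append nth_tl)
      show "take (n + 1) (?D x) = x" using len by simp
    qed
    have onto: "y = ?D (take (n + 1) y)" "take (n + 1) y \<in> tuples d (n + 1)"
      if "y \<in> ?T" "\<forall>i\<in>{1..n}. y ! (n + i) = y ! i" for y
    proof -
      have len: "length y = 2 * n + 1" using that(1) by (rule length_tuples)
      show t: "take (n + 1) y \<in> tuples d (n + 1)"
        using that(1) len set_take_subset[of "n + 1" y] by (auto simp: tuples_def)
      show "y = ?D (take (n + 1) y)"
      proof (rule tuples_eqI[OF that(1) mem(1)[OF t]])
        fix p assume p: "p < 2 * n + 1"
        show "y ! p = ?D (take (n + 1) y) ! p"
        proof (cases "p \<le> n")
          case False
          then obtain i where i: "p = n + Suc i"
            using less_imp_Suc_add[of n p] by auto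
          then have "y ! p = y ! Suc i" using p bspec[OF that(2), of "Suc i"] by simp
          then show ?thesis using i p len by (simp add: nth_append nth_tl)
        qed (use len in \<open>simp add: nth_append\<close>)
      qed
    qed
    have mapK: "map ((!) (?D x)) ?K = map ((!) x) K" if x: "x \<in> tuples d (n + 1)" for x
    proof -
      have "?D x ! (n + k) = x ! k" if k: "k \<in> set K" for k
      proof -
        have "k \<in> {1..n}" using K k by blast
        then show ?thesis using mem(2)[OF x] length_tuples[OF x] by (simp add: nth_append)
      qed
      then show ?thesis by simp
    qed
    have "(\<Sum>y\<in>?T. if map ((!) y) ?K = i then ?A y * cnj (?A y) else 0)
        = (\<Sum>y\<in>?D ` tuples d (n + 1). if map ((!) y) ?K = i then ?A y * cnj (?A y) else 0)"
    proof (rule sum.mono_neutral_right)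
      show "\<forall>y\<in>?T - ?D ` tuples d (n + 1). (if map ((!) y) ?K = i then ?A y * cnj (?A y) else 0) = 0"
      proof
        fix y assume y: "y \<in> ?T - ?D ` tuples d (n + 1)"
        then have "\<not> (\<forall>i\<in>{1..n}. y ! (n + i) = y ! i)" using onto[of y] by blast
        then have "?A y = 0" unfolding amplified_eq[OF d] by auto
        then show "(if map ((!) y) ?K = i then ?A y * cnj (?A y) else 0) = 0" by simp
      qed
      show "?D ` tuples d (n + 1) \<subseteq> ?T" using mem(1) by blast
    qed simp
    also have "\<dots> = (\<Sum>x\<in>tuples d (n + 1). if map ((!) (?D x)) ?K = i then ?A (?D x) * cnj (?A (?D x)) else 0)"
    proof -
      have "inj_on ?D (tuples d (n + 1))"
        using mem(3) by (rule inj_on_inverseI)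
      then show ?thesis by (simp only: sum.reindex o_def)
    qed
    also have "\<dots> = (\<Sum>x\<in>tuples d (n + 1). if map ((!) x) K = i then ?U x * cnj (?U x) else 0)"
    proof (intro sum.cong refl)
      fix x assume x: "x \<in> tuples d (n + 1)"
      have "?A (?D x) = ?U x" using mem[OF x] by (simp add: amplified_eq[OF d])
      with mapK[OF x] show "(if map ((!) (?D x)) ?K = i then ?A (?D x) * cnj (?A (?D x)) else 0)
          = (if map ((!) x) K = i then ?U x * cnj (?U x) else 0)"
        by (simp only:)
    qed
    finally show ?thesis unfolding rdm_diagonal .
  qed
  ultimately show ?thesis by (simp only:)
qed

section \<open>From matrix indices to the inequality\<close>

text \<open>Induction that strips the lowest digit. It identifies equal tuples with equal matrix
  indices, so that dephasing yields a diagonal matrix.\<close>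

lemma digits_eq_iff:
  "r < d ^ k \<Longrightarrow> c < d ^ k \<Longrightarrow> digits d k r = digits d k c \<longleftrightarrow> r = c"
proof (induction k arbitrary: r c)
  case (Suc k)
  have digits_Suc: "digits d (Suc k) r = (r mod d) # digits d k (r div d)" for r
    unfolding digits_def
    by (simp add: upt_rec[of 0 "Suc k"] map_Suc_upt[symmetric] o_def div_mult2_eq del: upt_Suc)
  have "r div d < d ^ k" "c div d < d ^ k"
    using Suc.prems by (auto intro!: less_mult_imp_div_less simp: mult.commute)
  then have "digits d (Suc k) r = digits d (Suc k) c \<longleftrightarrow> r mod d = c mod d \<and> r div d = c div d"
    using Suc.IH by (auto simp: digits_Suc)
  then show ?case by (metis div_mult_mod_eq)
qed (simp add: digits_def)

theorem theorem5:
  fixes d n :: nat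
    and b :: "nat \<Rightarrow> nat \<Rightarrow> nat \<Rightarrow> complex"
    and alpha :: "nat \<Rightarrow> complex"
  assumes "d \<ge> 2" and "n \<ge> 2"
    and "\<forall>i\<in>{1..n}. \<forall>x<d. \<forall>y<d.
           (\<Sum>q<d. cnj (b i x q) * b i y q) = (if x = y then 1 else 0)"
    and "(\<Sum>x<d. (cmod (alpha x))\<^sup>2) = 1"
  shows "mutual_info d (2 * n + 1) (amplified d n b alpha) [2 * n] [2 * n - 1]
           \<le> mutual_info d (n + 1) (unamplified d n b alpha) [n] [n - 1]"
proof -
  let ?U = "unamplified d n b alpha" and ?A = "amplified d n b alpha"
  let ?fold = "\<lambda>k. foldl (\<lambda>psi i. measure_step d (n + 1) b i psi) (init_state d n b alpha) [1..<k]"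
  have d: "d > 0" using assms(1) by simp
  have onb: "orthonormal_basis d (b i)" if "i \<in> {1..n}" for i
    using assms(3) that unfolding orthonormal_basis_def by blast
  have last: "?U = measure_step d (n + 1) b n (?fold n)"
    using assms(2) by (simp add: unamplified_def)
  \<comment> \<open>Since \<open>n \<ge> 2\<close>, a second measurement can be split off, exposing
    the one made by ancilla \<open>n - 1\<close>.\<close>
  have "[1..<n] = [1..<n - 1] @ [n - 1]"
    using assms(2) upt_Suc_append[of 1 "n - 1"] by simp
  then have last2: "?U = measure_step d (n + 1) b n (measure_step d (n + 1) b (n - 1) (?fold (n - 1)))"
    unfolding last by simp
  have diag: "rdm d (n + 1) ?U [k] [r] [c] = 0"
    if "k = n \<or> k = n - 1" "r < d" "c < d" "r \<noteq> c" for k r c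
    using that(1)
  proof
    assume "k = n"
    then show ?thesis unfolding last
      using assms(2) that by (auto intro!: rdm_measure_step_diagonal onb)
  next
    assume "k = n - 1"
    then show ?thesis unfolding last2
      using assms(2) that by (auto intro!: rdm_measure_step_twice_diagonal onb)
  qed
  \<comment> \<open>These one-device matrices are already diagonal, so dephasing does not change
    them.\<close>
  have single: "entropy_of d (2 * n + 1) ?A [n + k] = entropy_of d (n + 1) ?U [k]"
    if k: "k = n \<or> k = n - 1" for k
  proof -
    have "set [k] \<subseteq> {1..n}" using k assms(2) by auto
    from rdm_amplified[OF d this]
    have "rdm d (2 * n + 1) ?A [n + k] [r] [c] = rdm d (n + 1) ?U [k] [r] [c]" if "r < d" "c < d" for r c
      using diag[OF k that] by simp
    then have "rdm_mat d (2 * n + 1) ?A [n + k] = rdm_mat d (n + 1) ?U [k]"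
      by (intro eq_matI) (auto simp: rdm_mat_def digits_def)
    then show ?thesis by (simp add: entropy_of_def)
  qed
  let ?K = "[n, n - 1]"
  \<comment> \<open>The joint entropy enters mutual information with a minus sign, so its increase
    under dephasing gives the claimed decrease.\<close>
  have pair: "entropy_of d (n + 1) ?U ?K \<le> entropy_of d (2 * n + 1) ?A (map ((+) n) ?K)"
  proof -
    have K: "set ?K \<subseteq> {1..n}" using assms(2) by auto
    obtain E :: "nat list set" and V
      where gram: "\<forall>i j. rdm d (n + 1) ?U ?K i j = (\<Sum>e\<in>E. V i e * cnj (V j e))"
      using rdm_gram[of d "n + 1" ?U ?K] by (elim exE)
    let ?B = "rdm_mat d (2 * n + 1) ?A (map ((+) n) ?K)"
    have B: "?B = mat (d ^ 2) (d ^ 2) (\<lambda>(r, c). if r = c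
        then rdm d (n + 1) ?U ?K (digits d 2 r) (digits d 2 r) else 0)"
      unfolding rdm_mat_def rdm_amplified[OF d K]
      by (intro eq_matI) (auto simp: digits_eq_iff numeral_2_eq_2)
    show ?thesis unfolding entropy_of_def
    proof (rule vn_entropy_le_diagonal_part[OF assms(1)])
      show "rdm_mat d (n + 1) ?U ?K \<in> carrier_mat (d ^ 2) (d ^ 2)"
        by (simp add: rdm_mat_def numeral_2_eq_2)
      show "?B \<in> carrier_mat (d ^ 2) (d ^ 2)" unfolding B by simp
      show "rdm_mat d (n + 1) ?U ?K $$ (i, j)
          = (\<Sum>e\<in>E. V (digits d 2 i) e * cnj (V (digits d 2 j) e))"
        if "i < d ^ 2" "j < d ^ 2" for i j
        using that gram[rule_format, of "digits d 2 i" "digits d 2 j"]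
        by (simp add: rdm_mat_def numeral_2_eq_2)
      show "diagonal_mat ?B" unfolding B by (simp add: diagonal_mat_def)
      show "?B $$ (i, i) = rdm_mat d (n + 1) ?U ?K $$ (i, i)" if "i < d ^ 2" for i
        unfolding B using that by (simp add: rdm_mat_def numeral_2_eq_2)
    qed
  qed
  have "n + (n - 1) = 2 * n - 1" using assms(2) by simp
  then show ?thesis
    using single[of n] single[of "n - 1"] pair unfolding mutual_info_def by (simp add: mult_2)
qed

end
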